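(* Let $(\mathcal{X}, \|\cdot\|_{\mathcal{X}})$ be a real Banach space, let $T:\ell_1([0,1])\rightarrow \mathcal{X}$ be a bounded linear operator which is injective and has separable range, and let $r>0$. Define $\|x\|_T=\|x\|_1+\|T(x)\|_{\mathcal{X}}$ for $x\in \ell_1([0,1])$. Then $(\ell_1([0,1]), \|\cdot\|_T)$ has the following property: any $r$-separated (with respect to $\|\cdot\|_T$) subset $\mathcal{Y}\subseteq \ell_1([0,1])$ whose cardinality is a regular uncountable cardinal has a subset $\mathcal{Z}\subseteq \mathcal{Y}$ of the same cardinality which is $(r+)$-separated (with respect to $\|\cdot\|_T$). In particular, $(\ell_1([0,1]), \|\cdot\|_T)$ does not admit any uncountable equilateral set.
   Context: All Banach spaces are over the reals. $\ell_1([0,1])$ is the space of all functions $x:[0,1]\to\mathbb{R}$ with $\|x\|_1=\sum_{t\in[0,1]}|x(t)|<\infty$ (so $[0,1]$ is treated as a discrete index set). A subset $\mathcal{Y}$ of a normed space is $\delta$-separated if $\|y-y'\|\geq \delta$ for all distinct $y,y'\in\mathcal{Y}$, and $(\delta+)$-separated if $\|y-y'\|>\delta$ for all distinct $y,y'\in\mathcal{Y}$. A subset $\mathcal{Y}$ is equilateral if there is a real $\rho>0$ such that $\|x-y\|=\rho$ for any two distinct $x,y\in\mathcal{Y}$. *)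

theory Defs
  imports "HOL-Analysis.Analysis"
begin

text \<open>The index set \<open>[0,1]\<close> is a subset of \<^typ>\<open>real\<close>; a function on it is represented by its
  extension by \<open>0\<close>, so that equality in the type is equality of functions on \<open>[0,1]\<close>.\<close>

typedef ell1 = "{x :: real \<Rightarrow> real. (\<forall>t. t \<notin> {0..1} \<longrightarrow> x t = 0) \<and> (\<lambda>t. \<bar>x t\<bar>) summable_on {0..1}}"
  morphisms ell1_apply Abs_ell1
  by (rule exI[of _ "\<lambda>_. 0"]) simp

setup_lifting type_definition_ell1

lemma ell1_summable: "(\<lambda>t. \<bar>ell1_apply x t\<bar>) summable_on {0..1}"
  using ell1_apply[of x] by simp

lemma abs_summable_add:
  fixes f g :: "'a \<Rightarrow> real"
  assumes "(\<lambda>t. \<bar>f t\<bar>) summable_on A" "(\<lambda>t. \<bar>g t\<bar>) summable_on A"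
  shows "(\<lambda>t. \<bar>f t + g t\<bar>) summable_on A"
  using assms summable_on_add[of f A g]
    summable_on_iff_abs_summable_on_real[of f A] summable_on_iff_abs_summable_on_real[of g A]
    summable_on_iff_abs_summable_on_real[of "\<lambda>t. f t + g t" A]
  by (simp only: real_norm_def)

instantiation ell1 :: real_vector
begin

lift_definition zero_ell1 :: ell1 is "\<lambda>_. 0" by simp

lift_definition plus_ell1 :: "ell1 \<Rightarrow> ell1 \<Rightarrow> ell1" is "\<lambda>x y t. x t + y t"
  by (simp add: abs_summable_add)

lift_definition uminus_ell1 :: "ell1 \<Rightarrow> ell1" is "\<lambda>x t. - x t" by simp

lift_definition minus_ell1 :: "ell1 \<Rightarrow> ell1 \<Rightarrow> ell1" is "\<lambda>x y t. x t - y t"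
proof -
  fix x y :: "real \<Rightarrow> real"
  assume "(\<forall>t. t \<notin> {0..1} \<longrightarrow> x t = 0) \<and> (\<lambda>t. \<bar>x t\<bar>) summable_on {0..1}"
    and "(\<forall>t. t \<notin> {0..1} \<longrightarrow> y t = 0) \<and> (\<lambda>t. \<bar>y t\<bar>) summable_on {0..1}"
  then show "(\<forall>t. t \<notin> {0..1} \<longrightarrow> x t - y t = 0) \<and> (\<lambda>t. \<bar>x t - y t\<bar>) summable_on {0..1}"
    using abs_summable_add[of x "{0..1}" "\<lambda>t. - y t"] by simp
qed

lift_definition scaleR_ell1 :: "real \<Rightarrow> ell1 \<Rightarrow> ell1" is "\<lambda>c x t. c * x t"
  by (simp add: abs_mult summable_on_cmult_right)

instance
  by standard (transfer; simp add: fun_eq_iff algebra_simps)+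

end

instantiation ell1 :: real_normed_vector
begin

lift_definition norm_ell1 :: "ell1 \<Rightarrow> real" is "\<lambda>x. \<Sum>\<^sub>\<infinity>t\<in>{0..1}. \<bar>x t\<bar>" .

definition "sgn_ell1 (x :: ell1) = x /\<^sub>R norm x"

definition "dist_ell1 (x :: ell1) y = norm (x - y)"

definition [code del]:
  "(uniformity :: (ell1 \<times> ell1) filter) = (INF e\<in>{0 <..}. principal {(x, y). dist x y < e})"

definition [code del]:
  "open (U :: ell1 set) = (\<forall>x\<in>U. eventually (\<lambda>(x', y). x' = x \<longrightarrow> y \<in> U) uniformity)"

instance
proof
  fix x y :: ell1 and a :: real
  show "dist x y = norm (x - y)" by (rule dist_ell1_def)
  show "sgn x = x /\<^sub>R norm x" by (rule sgn_ell1_def)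
  show "norm x = 0 \<longleftrightarrow> x = 0"
  proof
    assume "norm x = 0"
    then have "\<bar>ell1_apply x t\<bar> = 0" if "t \<in> {0..1}" for t
      using nonneg_infsum_le_0D[of "\<lambda>t. \<bar>ell1_apply x t\<bar>" "{0..1}" t] ell1_summable[of x] that
      by (simp add: norm_ell1.rep_eq)
    moreover have "ell1_apply x t = 0" if "t \<notin> {0..1}" for t
      using ell1_apply[of x] that by blast
    ultimately have "ell1_apply x = ell1_apply 0"
      by (auto simp: fun_eq_iff zero_ell1.rep_eq)
    then show "x = 0" by (simp add: ell1_apply_inject)
  qed (simp add: norm_ell1.rep_eq zero_ell1.rep_eq)
  show "norm (x + y) \<le> norm x + norm y"
  proof -
    have "(\<Sum>\<^sub>\<infinity>t\<in>{0..1}. \<bar>ell1_apply x t + ell1_apply y t\<bar>)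
        \<le> (\<Sum>\<^sub>\<infinity>t\<in>{0..1}. \<bar>ell1_apply x t\<bar> + \<bar>ell1_apply y t\<bar>)"
      by (intro infsum_mono abs_summable_add summable_on_add ell1_summable abs_triangle_ineq)
    also have "\<dots> = norm x + norm y"
      by (simp add: norm_ell1.rep_eq infsum_add ell1_summable)
    finally show ?thesis by (simp add: norm_ell1.rep_eq plus_ell1.rep_eq)
  qed
  show "norm (a *\<^sub>R x) = \<bar>a\<bar> * norm x"
    by (simp add: norm_ell1.rep_eq scaleR_ell1.rep_eq abs_mult infsum_cmult_right')
qed (simp_all add: uniformity_ell1_def open_ell1_def)

end

definition norm_T :: "(ell1 \<Rightarrow> 'a::real_normed_vector) \<Rightarrow> ell1 \<Rightarrow> real" where
  "norm_T T x = norm x + norm (T x)"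

text \<open>The following notions are taken with respect to a norm \<open>N\<close> on the vector space \<open>'a\<close> that need
  not be the norm of the type class.\<close>

definition separated_wrt :: "('a::real_vector \<Rightarrow> real) \<Rightarrow> real \<Rightarrow> 'a set \<Rightarrow> bool" where
  "separated_wrt N \<delta> Y \<longleftrightarrow> (\<forall>y\<in>Y. \<forall>y'\<in>Y. y \<noteq> y' \<longrightarrow> N (y - y') \<ge> \<delta>)"

definition strictly_separated_wrt :: "('a::real_vector \<Rightarrow> real) \<Rightarrow> real \<Rightarrow> 'a set \<Rightarrow> bool" where
  "strictly_separated_wrt N \<delta> Y \<longleftrightarrow> (\<forall>y\<in>Y. \<forall>y'\<in>Y. y \<noteq> y' \<longrightarrow> N (y - y') > \<delta>)"

definition equilateral_wrt :: "('a::real_vector \<Rightarrow> real) \<Rightarrow> 'a set \<Rightarrow> bool" where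
  "equilateral_wrt N Y \<longleftrightarrow> (\<exists>\<rho>>0. \<forall>x\<in>Y. \<forall>y\<in>Y. x \<noteq> y \<longrightarrow> N (x - y) = \<rho>)"

text \<open>For infinite \<open>Y\<close>, \<^term>\<open>regularCard (card_of Y)\<close> is regularity of the cardinality of \<open>Y\<close>;
  for finite nonempty \<open>Y\<close> it holds vacuously, as no subset is cofinal.\<close>

definition regular_uncountable :: "'a set \<Rightarrow> bool" where
  "regular_uncountable Y \<longleftrightarrow> uncountable Y \<and> regularCard (card_of Y)"

end

theory Submission
  imports Defs "HOL-Library.Countable_Set_Type"
begin

text \<open>
  Let \<open>\<kappa>\<close> be the cardinality of an \<open>r\<close>-separated set \<open>Y\<close>, and call sets of fewer than \<open>\<kappa>\<close> elements
  small. Outside any small set \<open>A\<close> of coordinates, all but a small set of \<open>y \<in> Y\<close> keep \<open>\<ell>\<^sub>1\<close>-mass at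
  least \<open>r / 2\<close>: otherwise, since \<open>\<ell>\<^sub>1(A)\<close> has small density and the range of \<open>T\<close> is separable, two
  elements of \<open>Y\<close> would be at distance below \<open>r\<close>.

  If, outside some small set \<open>C\<close>, each coordinate is charged by only a small set of \<open>y\<close>, then \<open>\<kappa>\<close> many \<open>y\<close> have
  supports pairwise disjoint off \<open>C\<close>; their \<open>\<ell>\<^sub>1\<close>-distances are at least \<open>r\<close>, and injectivity of \<open>T\<close>
  makes their \<open>T\<close>-distances larger than \<open>r\<close>.

  Otherwise, for some \<open>\<epsilon> > 0\<close>, outside any small set there is a coordinate where more than \<open>\<epsilon>\<close> is charged
  by \<open>\<kappa>\<close> many \<open>y\<close>. One selects \<open>\<kappa>\<close> many \<open>y\<close> recursively, each having mass greater than
  \<open>r / 2 + \<epsilon>\<close> on the part of its support not met before. A pair can then be at \<open>\<ell>\<^sub>1\<close>-distance at most \<open>r\<close> only if the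
  later element has mass at least \<open>2\<epsilon>\<close> on the fresh part of the earlier one. These fresh parts are disjoint,
  so each element has finitely many such predecessors, and a greedy colouring with countably many
  colours gives \<open>\<kappa>\<close> many elements without such pairs.
\<close>

subsection \<open>Regular uncountable cardinalities\<close>

lemma uncountable_iff_natLeq_ordLess: "uncountable A \<longleftrightarrow> (natLeq, card_of A) \<in> ordLess"
  by (metis countable_card_le_natLeq card_of_Well_order natLeq_Well_order not_ordLeq_iff_ordLess)

text \<open>The successor of \<open>natLeq\<close> is regular and embeds into every uncountable set.
  This reduces the claim on equilateral sets to regular cardinalities.\<close>

lemma uncountable_imp_regular_uncountable_subset:
  fixes Y :: "'a set"
  assumes "uncountable Y"
  obtains Y' where "Y' \<subseteq> Y" "regular_uncountable Y'"
proof -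
  include cardinal_syntax
  define k where "k = cardSuc natLeq"
  have k: "Card_order k" by (simp add: k_def cardSuc_Card_order natLeq_Card_order)
  have "natLeq <o |Y|"
    using assms by (simp add: uncountable_iff_natLeq_ordLess)
  then have "k \<le>o |Y|"
    unfolding k_def by (intro cardSuc_least natLeq_Card_order card_of_Card_order)
  moreover have kF: "|Field k| =o k" using k by (rule card_of_Field_ordIso)
  ultimately have "|Field k| \<le>o |Y|" using ordIso_ordLeq_trans by blast
  then obtain f where f: "inj_on f (Field k)" "f ` Field k \<subseteq> Y"
    using card_of_ordLeq[of "Field k" Y] by blast
  have "|Field k| =o |f ` Field k|"
    using f(1) by (metis card_of_ordIsoI inj_on_imp_bij_betw)
  then have iso: "k =o |f ` Field k|"
    using kF ordIso_symmetric ordIso_transitive by blast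
  have gt: "natLeq <o k" by (simp add: k_def cardSuc_greater natLeq_Card_order)
  then have gt': "natLeq <o |f ` Field k|" using iso ordLess_ordIso_trans by blast
  then have unc: "uncountable (f ` Field k)"
    by (simp add: uncountable_iff_natLeq_ordLess)
  have reg: "regularCard k"
    unfolding k_def by (rule infinite_cardSuc_regularCard[OF _ natLeq_Card_order]) (simp add: Field_natLeq)
  have "infinite (Field k)" using unc by (metis countable_finite finite_imageI)
  then have "Cinfinite k" using k by (simp add: cinfinite_def)
  then have "regularCard |f ` Field k|" using regularCard_ordIso[OF iso] reg by blast
  then show ?thesis using that f(2) unc by (simp add: regular_uncountable_def)
qed

section \<open>Sets of cardinality below a regular uncountable cardinal\<close>

locale regular_uncountable_set =
  fixes Y :: "'y set"
  assumes regular_uncountable: "regular_uncountable Y"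
begin

text \<open>The type \<open>'b\<close> is independent of that of \<open>Y\<close>, so sets of
  coordinates, of finite sets and of functions are all measured against one cardinal.\<close>

definition small :: "'b set \<Rightarrow> bool" where
  "small A \<longleftrightarrow> (card_of A, card_of Y) \<in> ordLess"

lemma uncountable: "uncountable Y"
  using regular_uncountable by (simp add: regular_uncountable_def)

lemma small_countable: "countable A \<Longrightarrow> small A"
proof -
  include cardinal_syntax
  assume "countable A"
  then have "|A| \<le>o natLeq" by (simp add: countable_card_le_natLeq)
  moreover have "natLeq <o |Y|"
    using uncountable by (simp add: uncountable_iff_natLeq_ordLess)
  ultimately show "small A" unfolding small_def using ordLeq_ordLess_trans by blast
qed

lemma small_ordLeq: "(card_of A, card_of B) \<in> ordLeq \<Longrightarrow> small B \<Longrightarrow> small A"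
  unfolding small_def by (rule ordLeq_ordLess_trans)

lemma small_subset: "A \<subseteq> B \<Longrightarrow> small B \<Longrightarrow> small A"
  by (blast intro: small_ordLeq card_of_mono1)

lemma small_image: "small A \<Longrightarrow> small (f ` A)"
  by (blast intro: small_ordLeq card_of_image)

text \<open>A regular infinite cardinal is stable under unions of fewer, smaller sets; this is where
  regularity is used.\<close>

lemma small_UN:
  assumes "small I" "\<And>i. i \<in> I \<Longrightarrow> small (A i)"
  shows "small (\<Union>i\<in>I. A i)"
proof -
  have "infinite Y" using uncountable countable_finite by blast
  then have "stable (card_of Y)"
    using regular_uncountable
    by (intro regularCard_stable)
      (simp_all only: card_of_card_order_on Field_card_of regular_uncountable_def not_False_eq_True)
  then show ?thesis
    using assms unfolding small_def by (rule stable_UNION)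
qed

lemma small_Un: "small A \<Longrightarrow> small B \<Longrightarrow> small (A \<union> B)"
  using small_UN[of UNIV "\<lambda>b. if b then A else B"] small_countable[of "UNIV :: bool set"]
  by (simp add: UNIV_bool Un_commute)

lemma not_small: "\<not> small Y"
  by (simp add: small_def ordLess_irreflexive)

lemma not_small_Diff: "\<not> small A \<Longrightarrow> small B \<Longrightarrow> \<not> small (A - B)"
  using small_Un[of "A - B" B] small_subset[of A "A - B \<union> B"] by blast

lemma pigeonhole:
  assumes "\<not> small W" "small I" "g ` W \<subseteq> I"
  obtains i where "i \<in> I" "\<not> small {w \<in> W. g w = i}"
proof (rule ccontr)
  assume "\<not> thesis"
  then have "\<forall>i\<in>I. small {w \<in> W. g w = i}" using that by blast
  then have "small (\<Union>i\<in>I. {w \<in> W. g w = i})" using assms(2) by (intro small_UN) auto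
  moreover have "W \<subseteq> (\<Union>i\<in>I. {w \<in> W. g w = i})" using assms(3) by auto
  ultimately show False using assms(1) small_subset by blast
qed

lemma not_small_two_elements:
  assumes "\<not> small W"
  obtains w w' where "w \<in> W" "w' \<in> W" "w \<noteq> w'"
proof -
  have "W \<noteq> {}" using assms small_countable by force
  then obtain w where "w \<in> W" by blast
  moreover have "W - {w} \<noteq> {}"
    using not_small_Diff[OF assms, of "{w}"] small_countable
    by (metis countable_empty countable_finite finite.emptyI finite.insertI)
  ultimately show ?thesis using that by blast
qed

lemma not_small_eqpoll:
  assumes "Z \<subseteq> Y" "\<not> small Z"
  shows "Z \<approx> Y"
proof -
  include cardinal_syntax
  have "|Y| \<le>o |Z|" using assms(2) unfolding small_def
    by (metis card_of_Well_order ordLess_or_ordLeq)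
  moreover have "|Z| \<le>o |Y|" using assms(1) by (rule card_of_mono1)
  ultimately have "|Z| =o |Y|" using ordIso_iff_ordLeq by blast
  then show ?thesis by (simp add: eqpoll_def card_of_ordIso)
qed

text \<open>Sets of size \<open>Suc n\<close> arise by inserting one element into sets of size
  \<open>n\<close>, so each size gives a small family, and there are countably many sizes.\<close>

lemma small_finite_subsets:
  assumes "small A"
  shows "small {F. F \<subseteq> A \<and> finite F}"
proof -
  have sm: "small {F. F \<subseteq> A \<and> finite F \<and> card F = n}" for n
  proof (induction n)
    case 0
    have "{F. F \<subseteq> A \<and> finite F \<and> card F = 0} \<subseteq> {{}}" by auto
    then show ?case by (meson countable_finite finite.intros small_countable small_subset)
  next
    case (Suc n)
    let ?P = "{F. F \<subseteq> A \<and> finite F \<and> card F = n}"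
    have "small (\<Union>a\<in>A. insert a ` ?P)"
      using Suc assms by (intro small_UN small_image)
    moreover have "{F. F \<subseteq> A \<and> finite F \<and> card F = Suc n} \<subseteq> (\<Union>a\<in>A. insert a ` ?P)"
    proof
      fix F assume F: "F \<in> {F. F \<subseteq> A \<and> finite F \<and> card F = Suc n}"
      then obtain a where a: "a \<in> F" by force
      then have "F = insert a (F - {a})" "F - {a} \<in> ?P" using F by auto
      then show "F \<in> (\<Union>a\<in>A. insert a ` ?P)" using a F by blast
    qed
    ultimately show ?case using small_subset by blast
  qed
  have "small (\<Union>n::nat. {F. F \<subseteq> A \<and> finite F \<and> card F = n})"
    by (intro small_UN sm small_countable) auto
  moreover have "{F. F \<subseteq> A \<and> finite F} \<subseteq> (\<Union>n::nat. {F. F \<subseteq> A \<and> finite F \<and> card F = n})"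
    by auto
  ultimately show ?thesis using small_subset by blast
qed

text \<open>Recursion along a well-order of \<open>Y\<close> whose proper initial segments are
  small: at each stage the elements chosen so far form an admissible \<open>B\<close>.\<close>

lemma transfinite_selection:
  assumes ex: "\<And>B. B \<subseteq> Y \<Longrightarrow> small B \<Longrightarrow> \<exists>y\<in>Y - B. Q B y"
  obtains Z R where "Z \<subseteq> Y" "\<not> small Z" "wf R" "total_on Z R"
    "\<forall>z\<in>Z. Q {z' \<in> Z. (z', z) \<in> R} z"
proof -
  define r where "r = card_of Y"
  have co: "Card_order r" by (simp add: r_def card_of_Card_order)
  have Fr: "Field r = Y" by (simp add: r_def Field_card_of)
  have wo: "Well_order r" using co by (simp add: card_order_on_well_order_on)
  have wf: "wf (r - Id)" using wo by (simp add: well_order_on_def)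
  have tot: "total_on Y r" using wo Fr by (simp add: well_order_on_def linear_order_on_def)
  define U where "U x = {z. (z, x) \<in> r - Id}" for x
  have U_sub: "U x \<subseteq> Y" for x using Fr by (auto simp: U_def Field_def)
  have U_small: "small (U x)" if "x \<in> Y" for x
  proof -
    have "U x = underS r x" by (auto simp: U_def underS_def)
    then show ?thesis using card_of_underS[OF co, of x] that Fr by (simp add: small_def r_def)
  qed
  \<comment> \<open>\<open>U x\<close> consists of the strict predecessors of \<open>x\<close>.
    Requiring \<open>f x\<close> to differ from all earlier values makes \<open>f\<close> injective,
    hence its image large.\<close>
  have "\<exists>f. \<forall>x. x \<in> Y \<longrightarrow> f x \<in> Y - f ` U x \<and> Q (f ` U x) (f x)"
  proof (rule dependent_wf_choice[OF wf, where P = "\<lambda>f x y. x \<in> Y \<longrightarrow> y \<in> Y - f ` U x \<and> Q (f ` U x) y"])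
    fix f g :: "'y \<Rightarrow> 'y" and x y
    assume "\<And>z. (z, x) \<in> r - Id \<Longrightarrow> f z = g z"
    then have "f ` U x = g ` U x" by (intro image_cong) (auto simp: U_def)
    then show "(x \<in> Y \<longrightarrow> y \<in> Y - f ` U x \<and> Q (f ` U x) y) = (x \<in> Y \<longrightarrow> y \<in> Y - g ` U x \<and> Q (g ` U x) y)"
      by simp
  next
    fix x :: 'y and f :: "'y \<Rightarrow> 'y"
    assume "\<And>y. (y, x) \<in> r - Id \<Longrightarrow> y \<in> Y \<longrightarrow> f y \<in> Y - f ` U y \<and> Q (f ` U y) (f y)"
    then have "f ` U x \<subseteq> Y" using U_sub[of x] by (auto simp: U_def)
    then show "\<exists>y. x \<in> Y \<longrightarrow> y \<in> Y - f ` U x \<and> Q (f ` U x) y"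
      using ex[of "f ` U x"] small_image[OF U_small] by blast
  qed
  then obtain f where f: "\<And>x. x \<in> Y \<Longrightarrow> f x \<in> Y - f ` U x" "\<And>x. x \<in> Y \<Longrightarrow> Q (f ` U x) (f x)"
    by blast
  have inj: "inj_on f Y"
  proof (rule inj_onI, rule ccontr)
    fix x y assume xy: "x \<in> Y" "y \<in> Y" "f x = f y" "x \<noteq> y"
    then have "x \<in> U y \<or> y \<in> U x" using tot by (auto simp: total_on_def U_def)
    then show False using xy f(1) by (metis DiffD2 image_eqI)
  qed
  define g where "g = the_inv_into Y f"
  have gf: "g (f x) = x" if "x \<in> Y" for x using that inj by (simp add: g_def the_inv_into_f_f)
  show ?thesis
  \<comment> \<open>The order is transported along \<open>f\<close>, so the predecessors of
    \<open>f x\<close> are exactly the values of \<open>f\<close> on \<open>U x\<close>.\<close>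
  proof (rule that[of "f ` Y" "inv_image (r - Id) g"])
    show "f ` Y \<subseteq> Y" using f(1) by blast
    show "\<not> small (f ` Y)"
    proof
      assume "small (f ` Y)"
      then have "small (g ` f ` Y)" by (rule small_image)
      moreover have "g ` f ` Y = Y" using gf by force
      ultimately show False using not_small by simp
    qed
    show "wf (inv_image (r - Id) g)" using wf by (rule wf_inv_image)
    show "total_on (f ` Y) (inv_image (r - Id) g)"
      using tot gf by (auto simp: total_on_def)
    show "\<forall>z\<in>f ` Y. Q {z' \<in> f ` Y. (z', z) \<in> inv_image (r - Id) g} z"
    proof
      fix z assume "z \<in> f ` Y"
      then obtain x where x: "x \<in> Y" "z = f x" by blast
      have "{z' \<in> f ` Y. (z', z) \<in> inv_image (r - Id) g} = f ` U x"
        using x gf U_sub[of x] by (auto simp: U_def)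
      then show "Q {z' \<in> f ` Y. (z', z) \<in> inv_image (r - Id) g} z"
        using f(2)[OF x(1)] x(2) by simp
    qed
  qed
qed

text \<open>Greedy colouring with natural numbers: each vertex avoids the finitely many colours of its
  earlier neighbours, and some colour class is not small.\<close>

lemma not_small_independent:
  assumes "\<not> small Z" "wf R"
    and fin: "\<And>z. z \<in> Z \<Longrightarrow> finite {z' \<in> Z. (z', z) \<in> R \<and> E z' z}"
  obtains Z' where "Z' \<subseteq> Z" "\<not> small Z'" "\<forall>z\<in>Z'. \<forall>z'\<in>Z'. (z', z) \<in> R \<longrightarrow> \<not> E z' z"
proof -
  define N where "N z = {z' \<in> Z. (z', z) \<in> R \<and> E z' z}" for z
  have "\<exists>c :: _ \<Rightarrow> nat. \<forall>z. z \<in> Z \<longrightarrow> c z \<notin> c ` N z"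
  proof (rule dependent_wf_choice[OF assms(2), where P = "\<lambda>c z n. z \<in> Z \<longrightarrow> n \<notin> c ` N z"])
    fix f g :: "_ \<Rightarrow> nat" and x n
    assume "\<And>z. (z, x) \<in> R \<Longrightarrow> f z = g z"
    then have "f ` N x = g ` N x" by (intro image_cong) (auto simp: N_def)
    then show "(x \<in> Z \<longrightarrow> n \<notin> f ` N x) = (x \<in> Z \<longrightarrow> n \<notin> g ` N x)" by simp
  next
    fix x and f :: "_ \<Rightarrow> nat"
    show "\<exists>n. x \<in> Z \<longrightarrow> n \<notin> f ` N x"
      using fin[of x] ex_new_if_finite[OF infinite_UNIV_nat, of "f ` N x"] by (auto simp: N_def)
  qed
  then obtain c :: "_ \<Rightarrow> nat" where c: "\<And>z. z \<in> Z \<Longrightarrow> c z \<notin> c ` N z" by blast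
  obtain n where n: "\<not> small {z \<in> Z. c z = n}"
    using pigeonhole[OF assms(1) small_countable, of UNIV c] by auto
  show ?thesis
  proof (rule that[OF _ n]; (intro ballI impI)?)
    fix z z' assume *: "z \<in> {z \<in> Z. c z = n}" "z' \<in> {z \<in> Z. c z = n}" "(z', z) \<in> R"
    then have "c z' \<notin> c ` N z" using c by auto
    then have "z' \<notin> N z" by blast
    then show "\<not> E z' z" using * by (auto simp: N_def)
  qed auto
qed

end

subsection \<open>Mass of an element on a set of coordinates\<close>

text \<open>\<open>U\<close> need not lie in \<open>[0,1]\<close>: elements vanish outside it, so
  complements can be taken in the whole type.\<close>

definition mass :: "real set \<Rightarrow> ell1 \<Rightarrow> real" where
  "mass U x = (\<Sum>\<^sub>\<infinity>t\<in>U. \<bar>ell1_apply x t\<bar>)"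

definition supp :: "ell1 \<Rightarrow> real set" where
  "supp x = {t. ell1_apply x t \<noteq> 0}"

lemma ell1_apply_outside: "t \<notin> {0..1} \<Longrightarrow> ell1_apply x t = 0"
  using ell1_apply[of x] by blast

lemma summable_on_ell1: "(\<lambda>t. \<bar>ell1_apply x t\<bar>) summable_on U"
proof -
  have "(\<lambda>t. \<bar>ell1_apply x t\<bar>) summable_on UNIV"
    using ell1_summable[of x]
    by (rule summable_on_cong_neutral[THEN iffD1, rotated -1]) (auto simp: ell1_apply_outside)
  then show ?thesis by (rule summable_on_subset_banach) simp
qed

lemma norm_eq_mass: "norm x = mass UNIV x"
  unfolding norm_ell1.rep_eq mass_def
  by (rule infsum_cong_neutral) (auto simp: ell1_apply_outside)

lemma mass_mono: "U \<subseteq> V \<Longrightarrow> mass U x \<le> mass V x"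
  unfolding mass_def by (rule infsum_mono_neutral) (auto simp: summable_on_ell1)

lemma mass_le_norm: "mass U x \<le> norm x"
  by (simp add: norm_eq_mass mass_mono)

lemma mass_Un_disjoint: "U \<inter> V = {} \<Longrightarrow> mass (U \<union> V) x = mass U x + mass V x"
  unfolding mass_def by (rule infsum_Un_disjoint) (auto simp: summable_on_ell1)

lemma mass_finite: "finite F \<Longrightarrow> mass F x = (\<Sum>t\<in>F. \<bar>ell1_apply x t\<bar>)"
  by (simp add: mass_def)

lemma mass_Int_supp: "mass (U \<inter> supp x) x = mass U x"
  unfolding mass_def by (rule infsum_cong_neutral) (auto simp: supp_def)

lemma mass_eq_0: "U \<inter> supp x = {} \<Longrightarrow> mass U x = 0"
  using mass_Int_supp[of U x] by (simp add: mass_def)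

lemma mass_diff_le: "mass U (x - y) \<le> mass U x + mass U y"
proof -
  have "mass U (x - y) \<le> (\<Sum>\<^sub>\<infinity>t\<in>U. \<bar>ell1_apply x t\<bar> + \<bar>ell1_apply y t\<bar>)"
    unfolding mass_def
    by (intro infsum_mono summable_on_add summable_on_ell1) (simp add: minus_ell1.rep_eq)
  also have "\<dots> = mass U x + mass U y"
    unfolding mass_def by (intro infsum_add summable_on_ell1)
  finally show ?thesis .
qed

lemma mass_diff_ge: "mass U x - mass U y \<le> mass U (x - y)"
  using mass_diff_le[of U x "x - (x - y)"] mass_diff_le[of U "x - y" "- y"]
  by (simp add: mass_def uminus_ell1.rep_eq)

lemma mass_diff_commute: "mass U (x - y) = mass U (y - x)"
  unfolding mass_def by (rule infsum_cong) (simp add: minus_ell1.rep_eq abs_minus_commute)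

text \<open>The reverse triangle inequality is applied on \<open>U\<close> in favour of
  \<open>x\<close> and on \<open>V\<close> in favour of \<open>y\<close>. It is used for
  \<open>U\<close> and \<open>V\<close> inside the supports of \<open>x\<close> and
  \<open>y\<close>.\<close>

lemma norm_diff_ge_two_masses:
  assumes "U \<inter> V = {}"
  shows "mass U x - mass U y + (mass V y - mass V x) \<le> norm (x - y)"
proof -
  have "mass (U \<union> V) (x - y) = mass U (x - y) + mass V (y - x)"
    using mass_Un_disjoint[OF assms] mass_diff_commute by simp
  then show ?thesis
    using mass_le_norm[of "U \<union> V" "x - y"] mass_diff_ge[of U x y] mass_diff_ge[of V y x] by linarith
qed

lemma sum_mass_disjoint_le_norm:
  assumes "finite G" "disjoint_family_on U G"
  shows "(\<Sum>g\<in>G. mass (U g) x) \<le> norm x"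
proof -
  have "(\<Sum>g\<in>G. mass (U g) x) = mass (\<Union>g\<in>G. U g) x"
    using assms
  proof (induction G rule: finite_induct)
    case empty
    then show ?case by (simp add: mass_def)
  next
    case (insert a G)
    have "U a \<inter> (\<Union>g\<in>G. U g) = {}"
      using insert.prems insert.hyps(2) by (auto simp: disjoint_family_on_def)
    moreover have "disjoint_family_on U G"
      using insert.prems by (rule disjoint_family_on_mono[rotated]) auto
    ultimately show ?case using insert by (simp add: mass_Un_disjoint)
  qed
  then show ?thesis by (simp add: mass_le_norm)
qed

text \<open>Any \<open>n\<close> disjoint pieces of mass at least \<delta> force
  \<open>norm x\<close> to be at least \<open>n\<close> times \<delta>.\<close>

lemma finite_large_mass:
  assumes "disjoint_family_on U I" "\<delta> > 0"
  shows "finite {i \<in> I. \<delta> \<le> mass (U i) x}"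
proof (rule ccontr)
  assume inf: "infinite {i \<in> I. \<delta> \<le> mass (U i) x}"
  obtain n :: nat where n: "norm x < real n * \<delta>"
    using ex_less_of_nat_mult[OF assms(2)] by auto
  obtain G where G: "G \<subseteq> {i \<in> I. \<delta> \<le> mass (U i) x}" "card G = n" "finite G"
    using infinite_arbitrarily_large[OF inf, of n] by blast
  have "real n * \<delta> \<le> (\<Sum>g\<in>G. mass (U g) x)"
    using sum_bounded_below[of G \<delta> "\<lambda>g. mass (U g) x"] G by auto
  also have "\<dots> \<le> norm x"
    using assms(1) G by (intro sum_mass_disjoint_le_norm) (auto simp: disjoint_family_on_def subset_iff)
  finally show False using n by simp
qed

lemma countable_supp: "countable (supp x)"
  using summable_countable_real[OF summable_on_ell1, of UNIV x] by (simp add: supp_def)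

lemma finite_approx_mass:
  assumes "\<epsilon> > 0"
  obtains F where "finite F" "F \<subseteq> U" "mass (U - F) x \<le> \<epsilon>"
proof -
  obtain F where F: "finite F" "F \<subseteq> U" "dist (\<Sum>t\<in>F. \<bar>ell1_apply x t\<bar>) (mass U x) \<le> \<epsilon>"
    unfolding mass_def using infsum_finite_approximation[OF summable_on_ell1 assms] by blast
  have "mass U x = mass F x + mass (U - F) x"
    using mass_Un_disjoint[of F "U - F" x] F(2) by (simp add: Un_absorb1)
  then show ?thesis using that F by (simp add: mass_finite dist_real_def abs_le_iff)
qed

section \<open>Large subsets with pairwise close elements\<close>

context regular_uncountable_set
begin

text \<open>Rounding finitely many coordinates to a grid leaves countably many cells, one of which
  contains a large subset.\<close>

lemma close_on_finite:
  assumes "\<not> small W" "finite F" "\<epsilon> > 0"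
  obtains W' where "W' \<subseteq> W" "\<not> small W'" "\<forall>x\<in>W'. \<forall>y\<in>W'. mass F (x - y) \<le> \<epsilon>"
proof -
  \<comment> \<open>The \<open>card F\<close> coordinates then contribute at most \<epsilon>
    together; the added 1 covers empty \<open>F\<close>.\<close>
  define N where "N = \<epsilon> / (real (card F) + 1)"
  have N: "N > 0" using assms(3) by (simp add: N_def)
  define g where "g x = (\<lambda>t\<in>F. \<lfloor>ell1_apply x t / N\<rfloor>)" for x
  have "countable (Pi\<^sub>E F (\<lambda>_. UNIV :: int set))"
    using assms(2) by (intro countable_PiE) auto
  then have "small (Pi\<^sub>E F (\<lambda>_. UNIV :: int set))" by (rule small_countable)
  moreover have "g ` W \<subseteq> Pi\<^sub>E F (\<lambda>_. UNIV)" by (auto simp: g_def)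
  ultimately obtain h where h: "\<not> small {x \<in> W. g x = h}"
    by (rule pigeonhole[OF assms(1)])
  show ?thesis
  proof (rule that[OF _ h]; (intro ballI)?)
    fix x y assume "x \<in> {x \<in> W. g x = h}" "y \<in> {x \<in> W. g x = h}"
    then have gxy: "g x = g y" by simp
    have "\<bar>ell1_apply (x - y) t\<bar> \<le> N" if "t \<in> F" for t
    proof -
      have "\<lfloor>ell1_apply x t / N\<rfloor> = \<lfloor>ell1_apply y t / N\<rfloor>"
        using fun_cong[OF gxy, of t] that by (simp add: g_def)
      then have "\<bar>ell1_apply x t / N - ell1_apply y t / N\<bar> \<le> 1" by linarith
      then show ?thesis
        using N by (simp add: minus_ell1.rep_eq abs_le_iff field_simps)
    qed
    then have "mass F (x - y) \<le> real (card F) * N"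
      using assms(2) sum_bounded_above[of F "\<lambda>t. \<bar>ell1_apply (x - y) t\<bar>" N] by (simp add: mass_finite)
    also have "\<dots> \<le> \<epsilon>" using assms(3) by (simp add: N_def field_simps)
    finally show "mass F (x - y) \<le> \<epsilon>" .
  qed blast
qed

text \<open>Each element carries all but a third of \<epsilon> of its mass in \<open>A\<close> on a
  finite subset. There are few finite subsets, so one serves a large set of elements, and the finite
  case applies to it.\<close>

lemma close_on_small:
  assumes "\<not> small W" "small A" "\<epsilon> > 0"
  obtains W' where "W' \<subseteq> W" "\<not> small W'" "\<forall>x\<in>W'. \<forall>y\<in>W'. mass A (x - y) \<le> \<epsilon>"
proof -
  have "\<epsilon> / 3 > 0" using assms(3) by simp
  have "\<forall>x. \<exists>F. F \<subseteq> A \<and> finite F \<and> mass (A - F) x \<le> \<epsilon> / 3"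
  proof
    fix x
    obtain F where "finite F" "F \<subseteq> A" "mass (A - F) x \<le> \<epsilon> / 3"
      by (rule finite_approx_mass[OF \<open>\<epsilon> / 3 > 0\<close>])
    then show "\<exists>F. F \<subseteq> A \<and> finite F \<and> mass (A - F) x \<le> \<epsilon> / 3" by blast
  qed
  from choice[OF this] obtain f
    where f: "\<And>x. f x \<subseteq> A" "\<And>x. finite (f x)" "\<And>x. mass (A - f x) x \<le> \<epsilon> / 3" by auto
  have "f ` W \<subseteq> {F. F \<subseteq> A \<and> finite F}" using f(1,2) by auto
  then obtain F where "F \<in> {F. F \<subseteq> A \<and> finite F}" and F3: "\<not> small {x \<in> W. f x = F}"
    by (rule pigeonhole[OF assms(1) small_finite_subsets[OF assms(2)]])
  then have F: "F \<subseteq> A" "finite F" by auto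
  obtain W' where W': "W' \<subseteq> {x \<in> W. f x = F}" "\<not> small W'"
    "\<forall>x\<in>W'. \<forall>y\<in>W'. mass F (x - y) \<le> \<epsilon> / 3"
    by (rule close_on_finite[OF F3 F(2) \<open>\<epsilon> / 3 > 0\<close>])
  show ?thesis
  proof (rule that[OF _ W'(2)]; (intro ballI)?)
    fix x y assume xy: "x \<in> W'" "y \<in> W'"
    then have "f x = F" "f y = F" using W'(1) by auto
    then have "mass (A - F) x \<le> \<epsilon> / 3" "mass (A - F) y \<le> \<epsilon> / 3" using f(3)[of x] f(3)[of y] by simp_all
    moreover have "mass A (x - y) = mass F (x - y) + mass (A - F) (x - y)"
      using mass_Un_disjoint[of F "A - F" "x - y"] F(1) by (simp add: Un_absorb1)
    ultimately show "mass A (x - y) \<le> \<epsilon>"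
      using W'(3)[rule_format, OF xy] mass_diff_le[of "A - F" x y] by linarith
  qed (use W'(1) in blast)
qed

text \<open>Each image has a nearby point in a countable dense set, and one such point serves a
  large set of elements.\<close>

lemma close_images:
  fixes T :: "'b \<Rightarrow> 'c::metric_space"
  assumes "\<not> small W" "separable_space (top_of_set (range T))" "\<epsilon> > 0"
  obtains W' where "W' \<subseteq> W" "\<not> small W'" "\<forall>x\<in>W'. \<forall>y\<in>W'. dist (T x) (T y) < \<epsilon>"
proof -
  obtain D where D: "countable D" "top_of_set (range T) closure_of D = range T"
    using assms(2) by (auto simp: separable_space_def)
  have "\<exists>d\<in>D. dist d (T x) < \<epsilon> / 2" for x
  proof -
    have "range T \<subseteq> closure (range T \<inter> D)"
      using D(2) by (simp add: closure_of_subtopology) blast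
    then have "T x \<in> closure D"
      using closure_mono[of "range T \<inter> D" D] by blast
    then show ?thesis using assms(3) by (meson closure_approachable half_gt_zero)
  qed
  then have "\<forall>x. \<exists>d. d \<in> D \<and> dist d (T x) < \<epsilon> / 2" by blast
  from choice[OF this] obtain d
    where d: "\<And>x. d x \<in> D" "\<And>x. dist (d x) (T x) < \<epsilon> / 2" by auto
  have "d ` W \<subseteq> D" using d(1) by auto
  then obtain c where c: "\<not> small {x \<in> W. d x = c}"
    by (rule pigeonhole[OF assms(1) small_countable[OF D(1)]])
  show ?thesis
  proof (rule that[OF _ c]; (intro ballI)?)
    fix x y assume "x \<in> {x \<in> W. d x = c}" "y \<in> {x \<in> W. d x = c}"
    then show "dist (T x) (T y) < \<epsilon>"
      using d(2)[of x] d(2)[of y] dist_triangle_half_r[of c "T x" \<epsilon> "T y"] by simp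
  qed blast
qed

end

subsection \<open>Strictly separated subsets\<close>

lemma norm_eq_mass_Compl: "norm x = mass A x + mass (- A) x"
  using mass_Un_disjoint[of A "- A" x] by (simp add: norm_eq_mass)

locale separated_ell1_set = regular_uncountable_set Y for Y :: "ell1 set" +
  fixes T :: "ell1 \<Rightarrow> 'a::banach" and r :: real
  assumes bounded_linear: "bounded_linear T"
    and inj: "inj T"
    and separable_range: "separable_space (top_of_set (range T))"
    and r_pos: "r > 0"
    and separated: "separated_wrt (norm_T T) r Y"
begin

text \<open>Injectivity makes the \<open>T\<close>-term positive, so a non-strict lower bound
  \<open>r\<close> on the \<ell>1-distance already gives strict separation.\<close>

lemma norm_less_norm_T:
  assumes "x \<noteq> y"
  shows "norm (x - y) < norm_T T (x - y)"
proof -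
  have "T x \<noteq> T y" using inj assms by (simp add: inj_eq)
  then show ?thesis using bounded_linear by (simp add: norm_T_def linear_diff bounded_linear.linear)
qed

lemma small_mass_outside_less:
  assumes "small A"
  shows "small {y \<in> Y. mass (- A) y < r / 2}"
proof (rule ccontr)
  assume ns: "\<not> small {y \<in> Y. mass (- A) y < r / 2}"
  \<comment> \<open>The strict inequality is split into countably many cases with a uniform gap, one
    of which is large.\<close>
  define W where "W n = {y \<in> Y. mass (- A) y \<le> r / 2 - 1 / real (Suc n)}" for n
  have "{y \<in> Y. mass (- A) y < r / 2} \<subseteq> (\<Union>n. W n)"
  proof
    fix y assume y: "y \<in> {y \<in> Y. mass (- A) y < r / 2}"
    then obtain n where "1 / real (Suc n) < r / 2 - mass (- A) y"
      using nat_approx_posE[of "r / 2 - mass (- A) y"] by auto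
    then show "y \<in> (\<Union>n. W n)" using y by (auto simp: W_def intro!: exI[of _ n])
  qed
  then have "\<not> small (\<Union>n. W n)" using ns small_subset by blast
  then obtain n where n: "\<not> small (W n)"
    using small_UN[of UNIV W] small_countable[of "UNIV :: nat set"] by auto
  define \<epsilon> where "\<epsilon> = 1 / real (Suc n)"
  have \<epsilon>: "\<epsilon> / 2 > 0" by (simp add: \<epsilon>_def)
  obtain W1 where W1: "W1 \<subseteq> W n" "\<not> small W1"
    "\<forall>x\<in>W1. \<forall>y\<in>W1. mass A (x - y) \<le> \<epsilon> / 2"
    by (rule close_on_small[OF n assms \<epsilon>])
  obtain W2 where W2: "W2 \<subseteq> W1" "\<not> small W2"
    "\<forall>x\<in>W2. \<forall>y\<in>W2. dist (T x) (T y) < \<epsilon> / 2"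
    by (rule close_images[OF W1(2) separable_range \<epsilon>])
  obtain x y where xy: "x \<in> W2" "y \<in> W2" "x \<noteq> y"
    using not_small_two_elements[OF W2(2)] by blast
  have "x \<in> W n" "y \<in> W n" using xy W1(1) W2(1) by auto
  \<comment> \<open>The gap is gained twice, once per element. The part on \<open>A\<close> and the
    \<open>T\<close>-term together cost at most \<epsilon>, which leaves the distance below
    \<open>r\<close>.\<close>
  then have "mass (- A) (x - y) \<le> r - 2 * \<epsilon>"
    using mass_diff_le[of "- A" x y] by (simp add: W_def \<epsilon>_def)
  moreover have "mass A (x - y) \<le> \<epsilon> / 2" using W1(3) W2(1) xy by blast
  moreover have "norm (T (x - y)) < \<epsilon> / 2"
    using W2(3)[rule_format, OF xy(1,2)] bounded_linear
    by (simp add: dist_norm linear_diff bounded_linear.linear)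
  ultimately have "norm_T T (x - y) < r"
    using norm_eq_mass_Compl[of "x - y" A] \<epsilon> by (simp add: norm_T_def)
  moreover have "norm_T T (x - y) \<ge> r"
    using separated \<open>x \<in> W n\<close> \<open>y \<in> W n\<close> xy(3) by (simp add: separated_wrt_def W_def)
  ultimately show False by simp
qed

text \<open>The recursion picks elements of mass at least \<open>r / 2\<close> off \<open>C\<close>
  whose supports meet earlier ones only inside \<open>C\<close>; off \<open>C\<close> the masses of
  a pair add up.\<close>

lemma strictly_separated_if_small_common:
  assumes "small C" and C: "\<And>t. t \<notin> C \<Longrightarrow> small {y \<in> Y. t \<in> supp y}"
  shows "\<exists>Z\<subseteq>Y. \<not> small Z \<and> strictly_separated_wrt (norm_T T) r Z"
proof -
  define Q where "Q B y \<longleftrightarrow> r / 2 \<le> mass (- C) y \<and> (\<forall>z\<in>B. supp y \<inter> supp z \<subseteq> C)" for B y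
  have "\<exists>y\<in>Y - B. Q B y" if B: "B \<subseteq> Y" "small B" for B
  proof -
    \<comment> \<open>The coordinates off \<open>C\<close> already in use. Each is charged by a
      small set of elements, so avoiding all of them excludes only a small set.\<close>
    define S where "S = (\<Union>z\<in>B. supp z) - C"
    have "small S"
      unfolding S_def
      by (rule small_subset[of _ "\<Union>z\<in>B. supp z"])
        (auto intro: small_UN small_countable countable_supp B(2))
    then have "small (\<Union>t\<in>S. {y \<in> Y. t \<in> supp y})"
      by (rule small_UN) (auto simp: S_def intro: C)
    then have "small (B \<union> ({y \<in> Y. mass (- C) y < r / 2} \<union> (\<Union>t\<in>S. {y \<in> Y. t \<in> supp y})))"
      by (intro small_Un B(2) small_mass_outside_less assms(1))
    from not_small_Diff[OF not_small this] obtain y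
      where y: "y \<in> Y - (B \<union> ({y \<in> Y. mass (- C) y < r / 2} \<union> (\<Union>t\<in>S. {y \<in> Y. t \<in> supp y})))"
      by (rule not_small_two_elements)
    then have "Q B y" by (auto simp: Q_def S_def)
    then show ?thesis using y by blast
  qed
  then obtain Z R where Z: "Z \<subseteq> Y" "\<not> small Z" "wf R" "total_on Z R"
    "\<forall>z\<in>Z. Q {z' \<in> Z. (z', z) \<in> R} z"
    by (rule transfinite_selection)
  have "norm_T T (x - y) > r" if xy: "x \<in> Z" "y \<in> Z" "x \<noteq> y" for x y
  proof -
    have "supp x \<inter> supp y \<subseteq> C"
      using Z(4,5) xy unfolding total_on_def Q_def by blast
    then have disj: "(supp x - C) \<inter> supp y = {}" "(supp y - C) \<inter> supp x = {}"
      "(supp x - C) \<inter> (supp y - C) = {}" by auto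
    have eq: "mass (supp z - C) z = mass (- C) z" for z
      using mass_Int_supp[of "- C" z] by (simp add: Diff_eq Int_commute)
    have "r / 2 \<le> mass (- C) x" "r / 2 \<le> mass (- C) y"
      using Z(5) xy by (auto simp: Q_def)
    then have "r \<le> norm (x - y)"
      using norm_diff_ge_two_masses[of "supp x - C" "supp y - C" x y, OF disj(3)]
        mass_eq_0[OF disj(1)] mass_eq_0[OF disj(2)] eq[of x] eq[of y]
      by linarith
    then show ?thesis using norm_less_norm_T[OF xy(3)] by simp
  qed
  then show ?thesis using Z(1,2) by (intro exI[of _ Z]) (auto simp: strictly_separated_wrt_def)
qed

text \<open>The surplus \<epsilon> over \<open>r / 2\<close> in each of two elements tolerates an
  overlap below \<open>2 * \<epsilon>\<close>; larger overlaps are removed by colouring.\<close>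

lemma strictly_separated_if_many_common:
  assumes "\<epsilon> > 0"
    and ex: "\<And>A. small A \<Longrightarrow> \<exists>t. t \<notin> A \<and> \<not> small {y \<in> Y. \<epsilon> < \<bar>ell1_apply y t\<bar>}"
  shows "\<exists>Z\<subseteq>Y. \<not> small Z \<and> strictly_separated_wrt (norm_T T) r Z"
proof -
  define Q where "Q B y \<longleftrightarrow> r / 2 + \<epsilon> < mass (- (\<Union>z\<in>B. supp z)) y" for B y
  have "\<exists>y\<in>Y - B. Q B y" if B: "B \<subseteq> Y" "small B" for B
  proof -
    define A where "A = (\<Union>z\<in>B. supp z)"
    have A: "small A" unfolding A_def by (intro small_UN small_countable countable_supp B(2))
    obtain t where t: "t \<notin> A" "\<not> small {y \<in> Y. \<epsilon> < \<bar>ell1_apply y t\<bar>}" using ex[OF A] by blast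
    \<comment> \<open>Removing \<open>t\<close> along with \<open>A\<close> still leaves mass
      \<open>r / 2\<close>, so the entry at \<open>t\<close> comes on top of it.\<close>
    have "small (B \<union> {y \<in> Y. mass (- (A \<union> {t})) y < r / 2})"
      by (intro small_Un B(2) small_mass_outside_less A small_countable) simp
    from not_small_Diff[OF t(2) this] obtain y
      where y: "y \<in> {y \<in> Y. \<epsilon> < \<bar>ell1_apply y t\<bar>} - (B \<union> {y \<in> Y. mass (- (A \<union> {t})) y < r / 2})"
      by (rule not_small_two_elements)
    have "- A = {t} \<union> - (A \<union> {t})" using t(1) by blast
    then have "mass (- A) y = mass {t} y + mass (- (A \<union> {t})) y"
      using mass_Un_disjoint[of "{t}" "- (A \<union> {t})" y] by simp
    then have "Q B y" using y unfolding Q_def A_def[symmetric] by (auto simp: mass_finite)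
    then show ?thesis using y by blast
  qed
  then obtain Z R where Z: "Z \<subseteq> Y" "\<not> small Z" "wf R" "total_on Z R"
    "\<forall>z\<in>Z. Q {z' \<in> Z. (z', z) \<in> R} z"
    by (rule transfinite_selection)
  \<comment> \<open>The fresh part of \<open>z\<close>: it misses the supports of all earlier
    elements.\<close>
  define U where "U z = supp z - (\<Union>z'\<in>{z' \<in> Z. (z', z) \<in> R}. supp z')" for z
  have U_mass: "r / 2 + \<epsilon> < mass (U z) z" if "z \<in> Z" for z
  proof -
    have "U z = - (\<Union>z'\<in>{z' \<in> Z. (z', z) \<in> R}. supp z') \<inter> supp z" by (auto simp: U_def)
    then show ?thesis using Z(5)[rule_format, OF that] by (simp only: Q_def mass_Int_supp)
  qed
  have U_earlier: "U z \<inter> supp z' = {}" if "z' \<in> Z" "(z', z) \<in> R" for z z'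
    using that by (auto simp: U_def)
  have disj: "disjoint_family_on U Z"
    unfolding disjoint_family_on_def
  proof (intro ballI impI)
    fix x y assume xy: "x \<in> Z" "y \<in> Z" "x \<noteq> y"
    then have "(x, y) \<in> R \<or> (y, x) \<in> R" using Z(4) by (auto simp: total_on_def)
    then show "U x \<inter> U y = {}" using xy by (auto simp: U_def)
  qed
  obtain Z' where Z': "Z' \<subseteq> Z" "\<not> small Z'"
    "\<forall>z\<in>Z'. \<forall>z'\<in>Z'. (z', z) \<in> R \<longrightarrow> \<not> 2 * \<epsilon> \<le> mass (U z') z"
  proof (rule not_small_independent[OF Z(2,3), of "\<lambda>z' z. 2 * \<epsilon> \<le> mass (U z') z"])
    fix z assume "z \<in> Z"
    have "finite {z' \<in> Z. 2 * \<epsilon> \<le> mass (U z') z}"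
      using disj assms(1) by (intro finite_large_mass) auto
    then show "finite {z' \<in> Z. (z', z) \<in> R \<and> 2 * \<epsilon> \<le> mass (U z') z}"
      by (rule rev_finite_subset) auto
  qed
  have earlier: "norm_T T (x - y) > r" "norm_T T (y - x) > r"
    if xy: "x \<in> Z'" "y \<in> Z'" "x \<noteq> y" "(y, x) \<in> R" for x y
  proof -
    have Zxy: "x \<in> Z" "y \<in> Z" using xy Z'(1) by auto
    have "mass (U x) y = 0" using U_earlier[OF Zxy(2) xy(4)] by (rule mass_eq_0)
    moreover have "mass (U y) x < 2 * \<epsilon>" using Z'(3)[rule_format, OF xy(1,2,4)] by simp
    moreover have "U x \<inter> U y = {}" using disj Zxy xy(3) by (auto simp: disjoint_family_on_def)
    \<comment> \<open>Here \<open>y\<close> is the earlier element. The fresh parts contribute more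
      than \<open>r + 2 * \<epsilon>\<close>, of which the overlap of \<open>x\<close> with
      \<open>U y\<close> removes less than \<open>2 * \<epsilon>\<close>.\<close>
    ultimately have "r < norm (x - y)"
      using norm_diff_ge_two_masses[of "U x" "U y" x y] U_mass[OF Zxy(1)] U_mass[OF Zxy(2)] by simp
    then show "norm_T T (x - y) > r" "norm_T T (y - x) > r"
      using norm_less_norm_T[of x y] norm_less_norm_T[of y x] xy(3) by (simp_all add: norm_minus_commute)
  qed
  have "norm_T T (x - y) > r" if xy: "x \<in> Z'" "y \<in> Z'" "x \<noteq> y" for x y
  proof -
    have "(x, y) \<in> R \<or> (y, x) \<in> R" using Z(4) Z'(1) xy by (auto simp: total_on_def)
    then show ?thesis using earlier xy by blast
  qed
  then show ?thesis
    using Z(1) Z'(1,2) by (intro exI[of _ Z']) (auto simp: strictly_separated_wrt_def)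
qed

lemma strictly_separated_subset:
  "\<exists>Z\<subseteq>Y. Z \<approx> Y \<and> strictly_separated_wrt (norm_T T) r Z"
proof -
  have "\<exists>Z\<subseteq>Y. \<not> small Z \<and> strictly_separated_wrt (norm_T T) r Z"
  proof (cases "\<exists>\<epsilon>>0. \<forall>A. small A \<longrightarrow> (\<exists>t. t \<notin> A \<and> \<not> small {y \<in> Y. \<epsilon> < \<bar>ell1_apply y t\<bar>})")
    case True
    then obtain \<epsilon> where "\<epsilon> > 0"
      "\<And>A. small A \<Longrightarrow> \<exists>t. t \<notin> A \<and> \<not> small {y \<in> Y. \<epsilon> < \<bar>ell1_apply y t\<bar>}"
      by auto
    then show ?thesis by (rule strictly_separated_if_many_common)
  next
    case False
    \<comment> \<open>Failure for every positive threshold is used along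
      \<open>1 / real (Suc n)\<close>; the union of the exceptional sets serves as \<open>C\<close>,
      since every nonzero entry exceeds some threshold.\<close>
    have "\<forall>n. \<exists>A. small A \<and> (\<forall>t. t \<notin> A \<longrightarrow> small {y \<in> Y. 1 / real (Suc n) < \<bar>ell1_apply y t\<bar>})"
    proof
      fix n
      have "1 / real (Suc n) > 0" by simp
      then show "\<exists>A. small A \<and> (\<forall>t. t \<notin> A \<longrightarrow> small {y \<in> Y. 1 / real (Suc n) < \<bar>ell1_apply y t\<bar>})"
        using False by blast
    qed
    from choice[OF this] obtain A where A: "\<And>n. small (A n)"
      "\<And>n t. t \<notin> A n \<Longrightarrow> small {y \<in> Y. 1 / real (Suc n) < \<bar>ell1_apply y t\<bar>}"
      by auto
    show ?thesis
    proof (rule strictly_separated_if_small_common)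
      show "small (\<Union>n. A n)" by (intro small_UN A(1) small_countable) auto
      fix t assume t: "t \<notin> (\<Union>n. A n)"
      then have "small (\<Union>n. {y \<in> Y. 1 / real (Suc n) < \<bar>ell1_apply y t\<bar>})"
        by (intro small_UN A(2) small_countable) auto
      moreover have "{y \<in> Y. t \<in> supp y} \<subseteq> (\<Union>n. {y \<in> Y. 1 / real (Suc n) < \<bar>ell1_apply y t\<bar>})"
      proof
        fix y assume y: "y \<in> {y \<in> Y. t \<in> supp y}"
        then have "\<bar>ell1_apply y t\<bar> > 0" by (simp add: supp_def)
        then obtain n where "1 / real (Suc n) < \<bar>ell1_apply y t\<bar>" by (rule nat_approx_posE)
        then show "y \<in> (\<Union>n. {y \<in> Y. 1 / real (Suc n) < \<bar>ell1_apply y t\<bar>})" using y by blast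
      qed
      ultimately show "small {y \<in> Y. t \<in> supp y}" using small_subset by blast
    qed
  qed
  then show ?thesis using not_small_eqpoll by blast
qed

end

theorem theorem3:
  fixes T :: "ell1 \<Rightarrow> 'a::banach" and r :: real
  assumes "bounded_linear T"
    and "inj T"
    and "separable_space (top_of_set (range T))"
    and "r > 0"
  shows "(\<forall>Y. separated_wrt (norm_T T) r Y \<and> regular_uncountable Y \<longrightarrow>
            (\<exists>Z\<subseteq>Y. Z \<approx> Y \<and> strictly_separated_wrt (norm_T T) r Z))
       \<and> \<not> (\<exists>Y. uncountable Y \<and> equilateral_wrt (norm_T T) Y)"
proof -
  \<comment> \<open>Stated for every positive \<rho>, because the common distance of an equilateral
    set is unrelated to \<open>r\<close>.\<close>
  have main: "\<exists>Z\<subseteq>Y. Z \<approx> Y \<and> strictly_separated_wrt (norm_T T) \<rho> Z"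
    if "separated_wrt (norm_T T) \<rho> Y" "regular_uncountable Y" "\<rho> > 0" for \<rho> Y
  proof -
    interpret separated_ell1_set Y T \<rho>
      using assms that
      by (intro separated_ell1_set.intro regular_uncountable_set.intro separated_ell1_set_axioms.intro)
    show ?thesis by (rule strictly_separated_subset)
  qed
  have False if Y: "uncountable Y" "equilateral_wrt (norm_T T) Y" for Y
  proof -
    obtain \<rho> where \<rho>: "\<rho> > 0" "\<And>x y. x \<in> Y \<Longrightarrow> y \<in> Y \<Longrightarrow> x \<noteq> y \<Longrightarrow> norm_T T (x - y) = \<rho>"
      using Y(2) by (auto simp: equilateral_wrt_def)
    obtain Y' where Y': "Y' \<subseteq> Y" "regular_uncountable Y'"
      by (rule uncountable_imp_regular_uncountable_subset[OF Y(1)])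
    have "separated_wrt (norm_T T) \<rho> Y'"
      using \<rho>(2) Y'(1) by (auto simp: separated_wrt_def subset_iff)
    then obtain Z where Z: "Z \<subseteq> Y'" "Z \<approx> Y'" "strictly_separated_wrt (norm_T T) \<rho> Z"
      using main Y'(2) \<rho>(1) by blast
    \<comment> \<open>Only two distinct points of \<open>Z\<close> are needed: their distance would
      both equal and exceed \<rho>.\<close>
    have "uncountable Z"
      using Y'(2) countable_eqpoll[OF _ eqpoll_sym[OF Z(2)]] by (auto simp: regular_uncountable_def)
    then have "Z \<noteq> {}" "\<And>x. Z \<noteq> {x}" by auto
    then obtain x y where xy: "x \<in> Z" "y \<in> Z" "x \<noteq> y" by blast
    then have "norm_T T (x - y) > \<rho>" using Z(3) by (simp add: strictly_separated_wrt_def)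
    moreover have "norm_T T (x - y) = \<rho>" using \<rho>(2) xy Z(1) Y'(1) by blast
    ultimately show False by simp
  qed
  then show ?thesis using main assms(4) by blast
qed

end
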